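(* Let $$\tau=\left\{(u,v)\in\mathbb{R}^2:\ 0\le v\le1,\ 0\le u\le\left(\frac{v-1}{v+1}\right)^2\right\}.$$ Then $$\left(\mathrm{Sup}^{\mathrm{rec}}_{(1,1)}(\tau)\right)^2<0.023 .$$
   Context: For $n\ge1$ let $\mathcal{N}^{\mathrm{rec}}_{(n,n)}\subset\mathbb{Z}[x_1,x_2]$ be the $\mathbb{Z}$-span of the $N=n^2$ monomials $\mathfrak{m}_1,\dots,\mathfrak{m}_N$ of the form $x_1^ix_2^j$ with $0\le i,j<n$. For $\tau\subset\mathbb{C}^2$ put $t_n(\tau)=\sup_{(z_1,\dots,z_N)\in\tau^N}|\det(\mathfrak{m}_j(z_i))_{1\le i,j\le N}|$. The rectangular supremal transfinite diameter is $$\mathrm{Sup}^{\mathrm{rec}}_{(1,1)}(\tau)=\limsup_{n\to\infty}t_n(\tau)^{1/(n^2(n-1))}.$$ Subsets of $\mathbb{R}^2$ are regarded as subsets of $\mathbb{C}^2$. *)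

theory Defs
  imports
    Complex_Main
    "HOL-Library.FuncSet"
    "HOL-Library.Extended_Nonnegative_Real"
    "Jordan_Normal_Form.Determinant"
begin

(* The monomials x1^i x2^j with 0 <= i, j < n, numbered by k = i * n + j with 0 <= k < n^2.
   Another numbering would only permute the columns of the determinant below, which does not
   change its absolute value. *)
definition rec_monom :: "nat \<Rightarrow> nat \<Rightarrow> complex \<times> complex \<Rightarrow> complex" where
  "rec_monom n k = (\<lambda>(x1, x2). x1 ^ (k div n) * x2 ^ (k mod n))"

definition rec_matrix :: "nat \<Rightarrow> (nat \<Rightarrow> complex \<times> complex) \<Rightarrow> complex mat" where
  "rec_matrix n z = mat (n\<^sup>2) (n\<^sup>2) (\<lambda>(i, k). rec_monom n k (z i))"

(* The supremum is taken in [0,\<infinity>], so it is 0 if there is no point to choose and \<infinity> if the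
   determinants are unbounded on \<tau>. *)
definition rec_sup_det :: "nat \<Rightarrow> (complex \<times> complex) set \<Rightarrow> ennreal" where
  "rec_sup_det n \<tau> = (SUP z \<in> {..<n\<^sup>2} \<rightarrow>\<^sub>E \<tau>. ennreal (cmod (det (rec_matrix n z))))"

definition ennreal_root :: "nat \<Rightarrow> ennreal \<Rightarrow> ennreal" where
  "ennreal_root k x = (if x = \<infinity> then \<infinity> else ennreal (root k (enn2real x)))"

(* For n < 2 the root has index 0 and is meaningless, but the limsup ignores these terms. *)
definition sup_rec_transfinite_diameter :: "(complex \<times> complex) set \<Rightarrow> ennreal" where
  "sup_rec_transfinite_diameter \<tau> =
     limsup (\<lambda>n. ennreal_root (n\<^sup>2 * (n - 1)) (rec_sup_det n \<tau>))"

definition real_to_C2 :: "(real \<times> real) set \<Rightarrow> (complex \<times> complex) set" where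
  "real_to_C2 S = map_prod complex_of_real complex_of_real ` S"

end

theory Submission
  imports Defs "HOL-Real_Asymp.Real_Asymp"
begin

text \<open>Replacing each monomial by a polynomial that differs from it by monomials of smaller rank does not
  change the determinant, so \<open>t\<^sub>n\<close> is at most \<open>N!\<close> times the product of the suprema of these
  polynomials, and \<open>N!\<close> is negligible after taking the root. The exponents with \<open>max i j = m\<close> form two
  edges of a square. On the edge \<open>i = m\<close>, a lead \<open>u\<^sup>m v\<^sup>j\<close> is obtained as a product of Chebyshev
  polynomials in \<open>u\<close>, \<open>Q\<^sub>1\<close>, \<open>Q\<^sub>2\<close> and \<open>u v\<close>, where \<open>Q\<^sub>1, Q\<^sub>2\<close> have leads \<open>u\<^sup>3 v\<close> and \<open>u\<^sup>3 v\<^sup>2\<close>, other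
  terms of \<open>v\<close>-degree at most 3, and nearly minimal supremum on \<open>\<tau>\<close>; the other edge is treated in the
  same way with two polynomials in \<open>v\<close> and \<open>u\<close>. If \<open>Q\<close> is real with \<open>\<bar>Q\<bar> \<le> 2 r\<close>, its \<open>k\<close>-th Chebyshev
  polynomial is monic in \<open>Q\<close> and of size about \<open>r\<^sup>k\<close>. Summing the exponents gives
  \<open>Sup\<^sup>2 \<le> \<Lambda> powr (1 / 27)\<close> with an explicit rational \<open>\<Lambda>\<close>. The four suprema are bounded by positivity
  certificates for polynomials with integer coefficients.\<close>

section \<open>Positivity certificates\<close>

text \<open>A binary form with coefficients in ascending powers of \<open>x\<close>, of degree one
  less than the length. Homogeneity keeps the length under linear substitutions.\<close>

fun hom_eval :: "'a::comm_ring_1 list \<Rightarrow> 'a \<Rightarrow> 'a \<Rightarrow> 'a" where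
  "hom_eval [] x y = 0"
| "hom_eval (c # cs) x y = c * y ^ length cs + x * hom_eval cs x y"

lemma hom_eval_snoc: "hom_eval (cs @ [c]) x y = y * hom_eval cs x y + c * x ^ length cs"
  by (induction cs) (simp_all add: algebra_simps)

lemma hom_eval_rev: "hom_eval (rev cs) x y = hom_eval cs y x"
  by (induction cs) (simp_all add: hom_eval_snoc)

lemma hom_eval_nonneg:
  fixes x y :: "'a::linordered_idom"
  assumes "\<forall>c \<in> set cs. 0 \<le> c" "0 \<le> x" "0 \<le> y"
  shows "0 \<le> hom_eval cs x y"
  using assms by (induction cs) auto

lemma hom_eval_map2:
  assumes "length as = length bs"
    and "\<And>a b. a \<in> set as \<Longrightarrow> b \<in> set bs \<Longrightarrow> e (f a b) = e a + e b"
  shows "hom_eval (map e (map2 f as bs)) x y = hom_eval (map e as) x y + hom_eval (map e bs) x y"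
  using assms by (induction as bs rule: list_induct2) (simp_all add: algebra_simps)

text \<open>The coefficient type is left open, so that the same function splits in either variable: with
  integer coefficients in the inner variable, with coefficient lists in the outer one.\<close>

fun horner_shift :: "('a \<Rightarrow> 'a \<Rightarrow> 'a) \<Rightarrow> 'a \<Rightarrow> 'a list \<Rightarrow> 'a list" where
  "horner_shift f z [] = []"
| "horner_shift f z (c # cs) =
     (let r = horner_shift f z cs in map2 f (c # r) (r @ [z]))"

text \<open>Coefficients after the substitutions \<open>(x, x + y)\<close> and
  \<open>(x + y, y)\<close>, which map the quadrant onto its two halves. Reversing the list swaps
  the variables.\<close>

definition halves :: "('a \<Rightarrow> 'a \<Rightarrow> 'a) \<Rightarrow> 'a \<Rightarrow> 'a list \<Rightarrow> 'a list \<times> 'a list" where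
  "halves f z cs = (rev (horner_shift f z (rev cs)), horner_shift f z cs)"

lemma length_horner_shift [simp]: "length (horner_shift f z cs) = length cs"
  by (induction cs) (simp_all add: Let_def)

lemma length_halves [simp]:
  "length (fst (halves f z cs)) = length cs" "length (snd (halves f z cs)) = length cs"
  by (simp_all add: halves_def)

text \<open>The set \<open>S\<close> is there for coefficient rows: \<open>map2 (+)\<close>
  truncates, so it is additive only among rows of one fixed length.\<close>

locale additive_eval =
  fixes f :: "'a \<Rightarrow> 'a \<Rightarrow> 'a" and z :: 'a and S :: "'a set" and e :: "'a \<Rightarrow> 'b::comm_ring_1"
  assumes zero: "z \<in> S" "e z = 0"
    and closed: "\<And>a b. a \<in> S \<Longrightarrow> b \<in> S \<Longrightarrow> f a b \<in> S"
      "\<And>a b. a \<in> S \<Longrightarrow> b \<in> S \<Longrightarrow> e (f a b) = e a + e b"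
begin

lemma set_map2: "set as \<subseteq> S \<Longrightarrow> set bs \<subseteq> S \<Longrightarrow> set (map2 f as bs) \<subseteq> S"
proof (induction as arbitrary: bs)
  case (Cons a as)
  then show ?case by (cases bs) (auto intro: closed)
qed simp

text \<open>Horner's rule: if \<open>r\<close> represents the shifted tail, then
  \<open>c # r\<close> contributes \<open>x\<close> times it plus the new constant term, and
  \<open>r @ [z]\<close> contributes \<open>y\<close> times it.\<close>

lemma horner_shift:
  assumes "set cs \<subseteq> S"
  shows "set (horner_shift f z cs) \<subseteq> S"
    and "hom_eval (map e (horner_shift f z cs)) x y = hom_eval (map e cs) (x + y) y"
proof -
  have "set (horner_shift f z cs) \<subseteq> S \<and>
    hom_eval (map e (horner_shift f z cs)) x y = hom_eval (map e cs) (x + y) y"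
    using assms
  proof (induction cs)
    case (Cons c cs)
    let ?r = "horner_shift f z cs"
    have r: "set ?r \<subseteq> S" "hom_eval (map e ?r) x y = hom_eval (map e cs) (x + y) y" "c \<in> S"
      using Cons by auto
    have "set (map2 f (c # ?r) (?r @ [z])) \<subseteq> S"
      using r zero by (intro set_map2) auto
    moreover have "hom_eval (map e (map2 f (c # ?r) (?r @ [z]))) x y
        = hom_eval (map e (c # ?r)) x y + hom_eval (map e (?r @ [z])) x y"
      by (rule hom_eval_map2) (use r zero in \<open>auto intro!: closed\<close>)
    ultimately show ?case
      using r(2) zero(2) by (simp add: Let_def hom_eval_snoc algebra_simps)
  qed simp
  then show "set (horner_shift f z cs) \<subseteq> S"
    and "hom_eval (map e (horner_shift f z cs)) x y = hom_eval (map e cs) (x + y) y" by auto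
qed

lemma halves:
  assumes "set cs \<subseteq> S"
  shows "set (fst (halves f z cs)) \<subseteq> S" "set (snd (halves f z cs)) \<subseteq> S"
    and "hom_eval (map e (fst (halves f z cs))) x y = hom_eval (map e cs) x (x + y)"
    and "hom_eval (map e (snd (halves f z cs))) x y = hom_eval (map e cs) (x + y) y"
  using horner_shift(1)[of "rev cs"] horner_shift(2)[of "rev cs" y x] horner_shift[of cs] assms
  by (simp_all add: halves_def hom_eval_rev flip: rev_map) (simp add: add.commute)

end

interpretation int_eval: additive_eval "(+)" 0 UNIV real_of_int
  by unfold_locales simp_all

abbreviation row_eval :: "int list \<Rightarrow> real \<Rightarrow> real \<Rightarrow> real" where
  "row_eval r x y \<equiv> hom_eval (map real_of_int r) x y"

lemma row_eval_zero: "set r \<subseteq> {0} \<Longrightarrow> row_eval r x y = 0"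
  by (induction r) simp_all

lemma row_eval_uminus: "row_eval (map uminus r) x y = - row_eval r x y"
  by (induction r) simp_all

lemma additive_row_eval:
  "length z = k \<Longrightarrow> set z \<subseteq> {0} \<Longrightarrow>
    additive_eval (map2 (+)) z {r. length r = k} (\<lambda>r. row_eval r x y)"
proof unfold_locales
  assume "length z = k" "set z \<subseteq> {0}"
  then show "z \<in> {r. length r = k}" "row_eval z x y = 0"
    by (auto intro: row_eval_zero)
qed (simp_all add: hom_eval_map2 del: map_map)

text \<open>\<open>[x : y]\<close> and \<open>[t : w]\<close> are homogeneous coordinates on the positive quadrants. A quadrant is split
  along its diagonal, so no denominators appear; the two variables take turns.\<close>

fun nonneg_cert :: "nat \<Rightarrow> bool \<Rightarrow> int list list \<Rightarrow> bool" where
  "nonneg_cert 0 inner p = False"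
| "nonneg_cert (Suc n) inner p =
     (if \<forall>r \<in> set p. \<forall>c \<in> set r. 0 \<le> c then True
      else if inner then
        (if nonneg_cert n False (map (\<lambda>r. fst (halves (+) 0 r)) p)
         then nonneg_cert n False (map (\<lambda>r. snd (halves (+) 0 r)) p) else False)
      else
        (if nonneg_cert n True (fst (halves (map2 (+)) (map (\<lambda>_. 0) (hd p)) p))
         then nonneg_cert n True (snd (halves (map2 (+)) (map (\<lambda>_. 0) (hd p)) p)) else False))"

lemma quadrant_cases:
  fixes x y :: real
  assumes "0 \<le> x" "0 \<le> y"
  obtains y' where "0 \<le> y'" "y = x + y'" | x' where "0 \<le> x'" "x = x' + y"
  using assms by (metis add.commute le_add_diff_inverse nle_le diff_ge_0_iff_ge)

lemma nonneg_cert_sound: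
  assumes "nonneg_cert n inner p" "\<forall>r \<in> set p. length r = k"
    and "0 \<le> x" "0 \<le> y" "0 \<le> t" "0 \<le> w"
  shows "0 \<le> hom_eval (map (\<lambda>r. row_eval r t w) p) x y"
  using assms
proof (induction n inner p arbitrary: x y t w rule: nonneg_cert.induct)
  case (2 n inner p)
  show ?case
  proof (cases "\<forall>r \<in> set p. \<forall>c \<in> set r. 0 \<le> c")
    case True
    then show ?thesis
      using "2.prems" by (auto intro!: hom_eval_nonneg)
  next
    case False
    show ?thesis
    proof (cases inner)
      case True
      have cert: "nonneg_cert n False (map (\<lambda>r. fst (halves (+) 0 r)) p)"
          "nonneg_cert n False (map (\<lambda>r. snd (halves (+) 0 r)) p)"
        using "2.prems"(1) False True by (simp_all split: if_splits)
      show ?thesis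
      proof (rule quadrant_cases[OF \<open>0 \<le> t\<close> \<open>0 \<le> w\<close>])
        fix w' assume "0 \<le> w'" "w = t + w'"
        then show ?thesis
          using "2.IH"(1)[OF False True cert(1), of x y t w'] "2.prems" int_eval.halves(3)[of _ t w']
          by (simp add: comp_def)
      next
        fix t' assume "0 \<le> t'" "t = t' + w"
        then show ?thesis
          using "2.IH"(2)[OF False True cert(1,2), of x y t' w] "2.prems" int_eval.halves(4)[of _ t' w]
          by (simp add: comp_def)
      qed
    next
      case outer: False
      show ?thesis
      proof (cases "p = []")
        case nonempty: False
        let ?h = "halves (map2 (+)) (map (\<lambda>_. 0) (hd p)) p"
        interpret row: additive_eval "map2 (+)" "map (\<lambda>_. 0) (hd p)" "{r. length r = k}"
            "\<lambda>r. row_eval r t w"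
          using "2.prems"(2) nonempty by (intro additive_row_eval) auto
        have p: "set p \<subseteq> {r. length r = k}"
          using "2.prems"(2) by auto
        have cert: "nonneg_cert n True (fst ?h)" "nonneg_cert n True (snd ?h)"
          using "2.prems"(1) False outer by (simp_all split: if_splits)
        show ?thesis
        proof (rule quadrant_cases[OF \<open>0 \<le> x\<close> \<open>0 \<le> y\<close>])
          fix y' assume "0 \<le> y'" "y = x + y'"
          then show ?thesis
            using "2.IH"(3)[OF False outer cert(1), of x y' t w] "2.prems" row.halves(1)[OF p] row.halves(3)[OF p, of x y']
            by auto
        next
          fix x' assume "0 \<le> x'" "x = x' + y"
          then show ?thesis
            using "2.IH"(4)[OF False outer cert(1,2), of x' y t w] "2.prems" row.halves(2)[OF p] row.halves(4)[OF p, of x' y]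
            by auto
        qed
      qed simp
    qed
  qed
qed simp

section \<open>Pulling the region back to the unit square\<close>

definition mul_plus :: "int list \<Rightarrow> int list" where
  "mul_plus cs = map2 (+) (cs @ [0]) (0 # cs)"

definition mul_minus :: "int list \<Rightarrow> int list" where
  "mul_minus cs = map2 (+) (cs @ [0]) (0 # map uminus cs)"

lemma row_eval_mul_plus: "row_eval (mul_plus cs) x y = (y + x) * row_eval cs x y"
proof -
  have "row_eval (mul_plus cs) x y = row_eval (cs @ [0]) x y + row_eval (0 # cs) x y"
    unfolding mul_plus_def by (rule hom_eval_map2) auto
  then show ?thesis by (simp add: hom_eval_snoc algebra_simps)
qed

lemma row_eval_mul_minus: "row_eval (mul_minus cs) x y = (y - x) * row_eval cs x y"
proof -
  have "row_eval (mul_minus cs) x y = row_eval (cs @ [0]) x y + row_eval (0 # map uminus cs) x y"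
    unfolding mul_minus_def by (rule hom_eval_map2) auto
  then show ?thesis
    using row_eval_uminus[of cs x y] by (simp add: hom_eval_snoc algebra_simps)
qed

lemma length_mul [simp]: "length (mul_plus cs) = Suc (length cs)" "length (mul_minus cs) = Suc (length cs)"
  by (simp_all add: mul_plus_def mul_minus_def)

lemma funpow_mul:
  "row_eval ((mul_plus ^^ m) cs) x y = (y + x) ^ m * row_eval cs x y"
  "row_eval ((mul_minus ^^ m) cs) x y = (y - x) ^ m * row_eval cs x y"
  "length ((mul_plus ^^ m) cs) = m + length cs" "length ((mul_minus ^^ m) cs) = m + length cs"
  by (induction m) (simp_all add: row_eval_mul_plus row_eval_mul_minus)

text \<open>Row \<open>i\<close> of a \<open>4 \<times> 4\<close> coefficient table belongs to \<open>u\<^sup>i\<close>. Substituting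
  \<open>u = t ((1 - v) / (1 + v))\<^sup>2\<close> and clearing the denominator \<open>(1 + v)\<^sup>6\<close> leads to bidegree \<open>(3, 9)\<close>
  in \<open>(t, v) \<in> [0, 1]\<^sup>2\<close>; the last two \<open>halves\<close> pass from \<open>[0, 1]\<close> to quadrants.\<close>

definition pullback :: "int list list \<Rightarrow> int list list" where
  "pullback p = map (\<lambda>i. (mul_minus ^^ (2 * i)) ((mul_plus ^^ (6 - 2 * i)) (p ! i))) [0..<4]"

text \<open>Adding \<open>c\<close> to the constant coefficient turns a lower bound
  \<open>- c\<close> into nonnegativity. The number 60 only limits the recursion depth.\<close>

definition table_cert :: "int \<Rightarrow> int list list \<Rightarrow> bool" where
  "table_cert c p = nonneg_cert 60 True
     (map (\<lambda>r. fst (halves (+) 0 r)) (fst (halves (map2 (+)) (replicate 10 0)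
       (pullback (((c + hd (hd p)) # tl (hd p)) # tl p)))))"

definition table_eval :: "int list list \<Rightarrow> real \<Rightarrow> real \<Rightarrow> real" where
  "table_eval p u v = hom_eval (map (\<lambda>r. row_eval r v 1) p) u 1"

lemma table_cert_sound:
  assumes cert: "table_cert c p" and len: "length p = 4" "\<forall>r \<in> set p. length r = 4"
    and v: "0 \<le> v" "v \<le> 1" and u: "0 \<le> u" "u \<le> ((v - 1) / (v + 1))\<^sup>2"
  shows "0 \<le> c + table_eval p u v"
proof -
  let ?q = "((c + hd (hd p)) # tl (hd p)) # tl p"
  obtain r0 r1 r2 r3 where p: "p = [r0, r1, r2, r3]"
    using len(1) by (auto simp: length_Suc_conv numeral_eq_Suc)
  obtain a b where r0: "r0 = a # b"
    using len p by (cases r0) auto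
  have q: "table_eval ?q u v = c + table_eval p u v"
    by (simp add: p r0 table_eval_def algebra_simps)
  \<comment> \<open>At \<open>v = 1\<close> the quotient degenerates, but there
    \<open>u = 0\<close>, so the value 0 preserves the identity between \<open>u\<close> and
    \<open>t\<close>.\<close>
  define t where "t = (if v = 1 then 0 else u / ((v - 1) / (v + 1))\<^sup>2)"
  have t: "0 \<le> t" "t \<le> 1" "u * (1 + v)\<^sup>2 = t * (1 - v)\<^sup>2"
    using u v by (auto simp: t_def field_simps power_divide power2_commute)
  have pow: "u ^ i * (1 + v) ^ 6 = t ^ i * (1 - v) ^ (2 * i) * (1 + v) ^ (6 - 2 * i)" if "i < 4" for i
  proof -
    have "u ^ i * (1 + v) ^ 6 = (u * (1 + v)\<^sup>2) ^ i * (1 + v) ^ (6 - 2 * i)"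
      using that by (simp add: power_mult_distrib mult.assoc flip: power_mult power_add)
    then show ?thesis
      by (simp add: t power_mult_distrib flip: power_mult)
  qed
  have factor: "p6 * A0 + t * (a1 * A1 + t * (a2 * A2 + t * (a3 * A3)))
      = p6 * (A0 + u * (A1 + u * (A2 + u * A3)))"
    if "u * p6 = t * a1" "u\<^sup>2 * p6 = t\<^sup>2 * a2" "u ^ 3 * p6 = t ^ 3 * a3"
    for p6 a1 a2 a3 A0 A1 A2 A3 :: real
  proof -
    have "p6 * (A0 + u * (A1 + u * (A2 + u * A3)))
        = p6 * A0 + u * p6 * A1 + u\<^sup>2 * p6 * A2 + u ^ 3 * p6 * A3"
      by (simp add: algebra_simps power2_eq_square power3_eq_cube)
    then show ?thesis
      unfolding that by (simp add: algebra_simps power2_eq_square power3_eq_cube)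
  qed
  have pullback: "pullback [q0, q1, q2, q3] = [(mul_plus ^^ 6) q0, (mul_minus ^^ 2) ((mul_plus ^^ 4) q1),
      (mul_minus ^^ 4) ((mul_plus ^^ 2) q2), (mul_minus ^^ 6) q3]" for q0 q1 q2 q3
    by (simp add: pullback_def upt_rec del: funpow.simps)
  have four: "hom_eval [a0, a1, a2, a3] x 1 = a0 + x * (a1 + x * (a2 + x * a3))" for a0 a1 a2 a3 x :: real
    by simp
  have "hom_eval (map (\<lambda>r. row_eval r v 1) (pullback ?q)) t 1 = (1 + v) ^ 6 * table_eval ?q u v"
    using factor[OF pow[of 1, simplified, unfolded mult.assoc] pow[of 2, simplified, unfolded mult.assoc]
        pow[of 3, simplified]]
    by (simp only: p list.sel pullback table_eval_def list.map four funpow_mul mult_1_right mult.assoc)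
  moreover have "0 \<le> hom_eval (map (\<lambda>r. row_eval r v 1) (pullback ?q)) t 1"
  proof -
    have rows: "set (pullback ?q) \<subseteq> {r. length r = 10}"
      using len by (auto simp: pullback_def funpow_mul p r0 upt_rec)
    interpret row: additive_eval "map2 (+)" "replicate 10 0" "{r. length r = 10}" "\<lambda>r. row_eval r v 1"
      by (rule additive_row_eval) auto
    let ?h = "fst (halves (map2 (+)) (replicate 10 0) (pullback ?q))"
    have "0 \<le> hom_eval (map (\<lambda>r. row_eval r v (1 - v)) (map (\<lambda>r. fst (halves (+) 0 r)) ?h)) t (1 - t)"
      by (rule nonneg_cert_sound[OF cert[unfolded table_cert_def], of 10])
        (use row.halves(1)[OF rows] t v in auto)
    then show ?thesis
      using int_eval.halves(3)[of _ v "1 - v"] row.halves(3)[OF rows, of t "1 - t"] by (simp add: comp_def)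
  qed
  ultimately show ?thesis
    using v q by (simp add: zero_le_mult_iff zero_less_power_eq)
qed

section \<open>Chebyshev polynomials and leading terms\<close>

fun cheb :: "'a::comm_ring_1 \<Rightarrow> 'a \<Rightarrow> nat \<Rightarrow> 'a" where
  "cheb s q 0 = 1"
| "cheb s q (Suc 0) = q"
| "cheb s q (Suc (Suc k)) = q * cheb s q (Suc k) - s * cheb s q k"

text \<open>These are the Chebyshev polynomials of the second kind, rescaled to be monic: for
  \<open>w + cnj w = t\<close> and \<open>w * cnj w = r\<^sup>2\<close> the value is \<open>\<Sum>j\<le>k. w^(k-j) * cnj w^j\<close>.\<close>

lemma abs_cheb_le:
  fixes t r :: real
  assumes "\<bar>t\<bar> \<le> 2 * r"
  shows "\<bar>cheb (r\<^sup>2) t k\<bar> \<le> (real k + 1) * r ^ k"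
proof -
  have r: "0 \<le> r" using assms by linarith
  define w where "w = Complex (t / 2) (sqrt (r\<^sup>2 - (t / 2)\<^sup>2))"
  have "(t / 2)\<^sup>2 \<le> r\<^sup>2"
    using assms r by (intro abs_le_square_iff[THEN iffD1]) auto
  then have w: "w + cnj w = t" "cmod w = r"
    using r by (simp_all add: w_def complex_eq_iff cmod_def)
  have ww: "w * cnj w = (of_real r)\<^sup>2"
    using complex_norm_square[of w] unfolding w(2) of_real_power by (rule sym)
  let ?c = "\<lambda>k. complex_of_real (cheb (r\<^sup>2) t k)"
  \<comment> \<open>The recurrence is factored into first-order steps with ratios \<open>w\<close>
    and \<open>cnj w\<close>. No division by \<open>w - cnj w\<close> occurs, so the double root at
    the ends of the interval needs no separate case.\<close>
  have step: "?c (Suc k) - cnj w * ?c k = w ^ Suc k" for k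
  proof (induction k)
    case 0
    then show ?case unfolding cheb.simps w(1)[symmetric] by simp
  next
    case (Suc k)
    have "(w + w') * A - w * w' * B - w' * A = w * (A - w' * B)" for w' A B
      by (simp add: algebra_simps)
    then have "?c (Suc (Suc k)) - cnj w * ?c (Suc k) = w * (?c (Suc k) - cnj w * ?c k)"
      unfolding cheb.simps of_real_diff of_real_mult of_real_power ww[symmetric] w(1)[symmetric] .
    then show ?case using Suc by simp
  qed
  have "cmod (?c k) \<le> (real k + 1) * r ^ k"
  proof (induction k)
    case (Suc k)
    have "cmod (?c (Suc k)) \<le> cmod (w ^ Suc k) + cmod (cnj w * ?c k)"
      using step[of k] norm_triangle_ineq[of "w ^ Suc k" "cnj w * ?c k"] by (simp add: algebra_simps)
    also have "\<dots> \<le> r ^ Suc k + r * ((real k + 1) * r ^ k)"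
      using Suc r w(2) by (simp add: norm_mult norm_power mult_left_mono)
    finally show ?case by (simp add: algebra_simps)
  qed simp
  then show ?thesis by simp
qed

section \<open>Bivariate polynomials with a prescribed leading monomial\<close>

definition eval2 :: "real poly poly \<Rightarrow> real \<Rightarrow> real \<Rightarrow> real" where
  "eval2 f x y = poly (poly f [:x:]) y"

lemma eval2_simps [simp]:
  "eval2 1 x y = 1" "eval2 0 x y = 0" "eval2 (f * g) x y = eval2 f x y * eval2 g x y"
  "eval2 (f - g) x y = eval2 f x y - eval2 g x y" "eval2 (f ^ k) x y = eval2 f x y ^ k"
  "eval2 (pCons c f) x y = poly c y + x * eval2 f x y"
  by (simp_all add: eval2_def poly_power)

lemma eval2_cheb: "eval2 (cheb s q k) x y = cheb (eval2 s x y) (eval2 q x y) k"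
  by (induction k rule: induct_nat_012) simp_all

lemma eval2_as_sum:
  assumes "degree f < n" "\<And>i. degree (coeff f i) < n"
  shows "eval2 f x y = (\<Sum>a<n. \<Sum>b<n. coeff (coeff f a) b * x ^ a * y ^ b)"
proof -
  have sum: "poly p z = (\<Sum>i<n. coeff p i * z ^ i)" if "degree p < n" for p :: "'b::comm_ring_1 poly" and z
    unfolding poly_altdef using that by (intro sum.mono_neutral_left) (auto simp: coeff_eq_0)
  have "eval2 f x y = (\<Sum>a<n. poly (coeff f a) y * x ^ a)"
    by (simp add: eval2_def sum[OF assms(1)] poly_sum poly_power)
  also have "\<dots> = (\<Sum>a<n. \<Sum>b<n. coeff (coeff f a) b * x ^ a * y ^ b)"
    by (simp add: sum[OF assms(2)] sum_distrib_left mult_ac)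
  finally show ?thesis .
qed

text \<open>The lead is lexicographic, \<open>x\<close> first. The bound \<open>d\<close> on the
  \<open>y\<close>-degree is tracked separately because lower powers of \<open>x\<close> may carry
  higher powers of \<open>y\<close> than the lead.\<close>

definition lead_form :: "real poly poly \<Rightarrow> nat \<Rightarrow> nat \<Rightarrow> nat \<Rightarrow> bool" where
  "lead_form f a b d \<longleftrightarrow> degree f \<le> a \<and> degree (coeff f a) \<le> b \<and> coeff (coeff f a) b = 1 \<and>
     (\<forall>i. degree (coeff f i) \<le> d)"

lemma coeff_mult_top:
  assumes "degree f \<le> a" "degree g \<le> b"
  shows "coeff (f * g) (a + b) = coeff f a * coeff g b"
proof -
  have "coeff f i * coeff g (a + b - i) = 0" if "i \<le> a + b" "i \<noteq> a" for i
    using that assms by (cases "i < a") (auto simp: coeff_eq_0)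
  then have "coeff (f * g) (a + b) = (\<Sum>i\<in>{a}. coeff f i * coeff g (a + b - i))"
    unfolding coeff_mult by (intro sum.mono_neutral_right) auto
  then show ?thesis by simp
qed

lemma lead_form_mult:
  assumes "lead_form f a b d" "lead_form g a' b' d'"
  shows "lead_form (f * g) (a + a') (b + b') (d + d')"
proof -
  have top: "coeff (f * g) (a + a') = coeff f a * coeff g a'"
    using assms by (intro coeff_mult_top) (auto simp: lead_form_def)
  have "degree (coeff (f * g) i) \<le> d + d'" for i
    unfolding coeff_mult
    using assms by (intro degree_sum_le) (auto simp: lead_form_def intro: order.trans[OF degree_mult_le] add_mono)
  moreover have "coeff (coeff (f * g) (a + a')) (b + b') = 1"
    unfolding top using assms by (subst coeff_mult_top) (auto simp: lead_form_def)
  moreover have "degree (f * g) \<le> a + a'" "degree (coeff (f * g) (a + a')) \<le> b + b'"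
    unfolding top using assms by (auto simp: lead_form_def intro!: order.trans[OF degree_mult_le] add_mono)
  ultimately show ?thesis by (simp add: lead_form_def)
qed

lemma lead_form_one: "lead_form 1 0 0 0"
  by (simp add: lead_form_def coeff_1)

lemma lead_form_power: "lead_form f a b d \<Longrightarrow> lead_form (f ^ k) (k * a) (k * b) (k * d)"
proof (induction k)
  case (Suc k)
  then show ?case using lead_form_mult[of f a b d "f ^ k"] by simp
qed (simp add: lead_form_one)

text \<open>As \<open>a\<close> is positive, the subtracted term of the recurrence has too small an
  \<open>x\<close>-degree to touch the leading coefficient.\<close>

lemma lead_form_cheb:
  assumes "lead_form q a b d" "0 < a"
  shows "lead_form (cheb [:[:s:]:] q k) (k * a) (k * b) (k * d)"
proof (induction k rule: induct_nat_012)
  case 0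
  show ?case by (simp add: lead_form_one)
next
  case 1
  show ?case using assms by simp
next
  case (ge2 k)
  let ?f = "q * cheb [:[:s:]:] q (Suc k)" and ?g = "smult [:s:] (cheb [:[:s:]:] q k)"
  have f: "lead_form ?f (Suc (Suc k) * a) (Suc (Suc k) * b) (Suc (Suc k) * d)"
    using lead_form_mult[OF assms(1) ge2(2)] by simp
  have g: "degree ?g \<le> k * a" "degree (coeff ?g i) \<le> k * d" for i
    using ge2(1) degree_mult_le[of "[:s:]"] by (auto simp: lead_form_def intro: order.trans degree_smult_le)
  have "coeff ?g (Suc (Suc k) * a) = 0"
    using g(1) assms(2) by (intro coeff_eq_0) (simp add: le_less_trans[OF g(1)])
  moreover have "degree ?g \<le> Suc (Suc k) * a" "degree (coeff ?g i) \<le> Suc (Suc k) * d" for i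
    using g(1) g(2)[of i] by (simp_all add: trans_le_add2)
  ultimately have "lead_form (?f - ?g) (Suc (Suc k) * a) (Suc (Suc k) * b) (Suc (Suc k) * d)"
    using f unfolding lead_form_def by (simp add: degree_diff_le del: coeff_smult degree_smult_eq)
  then show ?case by simp
qed

lemma abs_eval2_cheb_le:
  "\<bar>eval2 q x y\<bar> \<le> 2 * r \<Longrightarrow> \<bar>eval2 (cheb [:[:r\<^sup>2:]:] q k) x y\<bar> \<le> (real k + 1) * r ^ k"
  by (simp add: eval2_cheb abs_cheb_le)

section \<open>Polynomials for one edge of a square of exponents\<close>

lemma prod_lessThan_add:
  fixes f :: "nat \<Rightarrow> 'a::comm_monoid_mult"
  shows "prod f {..<m + n} = prod f {..<m} * (\<Prod>i<n. f (m + i))"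
  by (induction n) (simp_all add: mult.assoc)

lemma sum_lessThan_double: "2 * (\<Sum>i<Suc n. i) = n * (n + 1)" for n :: nat
  by (induction n) simp_all

locale edge_family =
  fixes K :: "(real \<times> real) set" and Q\<^sub>1 Q\<^sub>2 :: "real poly poly" and r\<^sub>1 r\<^sub>2 r\<^sub>3 :: real
  assumes K: "\<And>x y. (x, y) \<in> K \<Longrightarrow> 0 \<le> x \<and> x \<le> 1 \<and> 0 \<le> y \<and> y \<le> 1 \<and> x * y \<le> 4 * r\<^sub>3"
    and lead: "lead_form Q\<^sub>1 3 1 3" "lead_form Q\<^sub>2 3 2 3"
    and bound: "\<And>x y. (x, y) \<in> K \<Longrightarrow> \<bar>eval2 Q\<^sub>1 x y\<bar> \<le> 2 * r\<^sub>1"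
      "\<And>x y. (x, y) \<in> K \<Longrightarrow> \<bar>eval2 Q\<^sub>2 x y\<bar> \<le> 2 * r\<^sub>2"
    and r: "0 < r\<^sub>1" "r\<^sub>1 \<le> 1" "0 < r\<^sub>2" "r\<^sub>2 \<le> 1" "0 < r\<^sub>3" "r\<^sub>3 \<le> 1"
begin

text \<open>\<open>X\<close> and \<open>W\<close> are \<open>x\<close> and \<open>x * y\<close>
  shifted by the midpoints of their ranges \<open>[0, 1]\<close> and
  \<open>[0, 4 * r\<^sub>3]\<close>, so their Chebyshev radii are 1/4 and
  \<open>r\<^sub>3\<close>.\<close>

definition X :: "real poly poly" where "X = [:[:- 1 / 2:], 1:]"

definition W :: "real poly poly" where "W = [:[:- 2 * r\<^sub>3:], [:0, 1:]:]"

lemma lead_XW: "lead_form X 1 0 0" "lead_form W 1 1 1"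
  by (auto simp: lead_form_def X_def W_def coeff_pCons split: nat.split)

lemma bound_XW:
  assumes "(x, y) \<in> K"
  shows "\<bar>eval2 X x y\<bar> \<le> 2 * (1 / 4)" "\<bar>eval2 W x y\<bar> \<le> 2 * r\<^sub>3"
proof -
  have "eval2 X x y = x - 1 / 2" "eval2 W x y = x * y - 2 * r\<^sub>3"
    by (simp_all add: X_def W_def)
  moreover have "0 \<le> x * y" using K[OF assms] by simp
  ultimately show "\<bar>eval2 X x y\<bar> \<le> 2 * (1 / 4)" "\<bar>eval2 W x y\<bar> \<le> 2 * r\<^sub>3"
    using K[OF assms] by linarith+
qed

text \<open>Lead exponents \<open>(3 q, j)\<close> with \<open>j \<le> 3 q\<close> are combined from those of two neighbours in the
  list \<open>X, Q\<^sub>1, Q\<^sub>2, W\<close>, that is, from \<open>(1, 0), (3, 1), (3, 2), (1, 1)\<close>.\<close>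

definition base :: "nat \<Rightarrow> nat \<Rightarrow> real poly poly" where
  "base q j =
    (if j \<le> q then cheb [:[:r\<^sub>1\<^sup>2:]:] Q\<^sub>1 j * cheb [:[:(1 / 4)\<^sup>2:]:] X (3 * (q - j))
     else if j \<le> 2 * q then cheb [:[:r\<^sub>1\<^sup>2:]:] Q\<^sub>1 (2 * q - j) * cheb [:[:r\<^sub>2\<^sup>2:]:] Q\<^sub>2 (j - q)
     else cheb [:[:r\<^sub>2\<^sup>2:]:] Q\<^sub>2 (3 * q - j) * cheb [:[:r\<^sub>3\<^sup>2:]:] W (3 * (j - 2 * q)))"

text \<open>The size of \<open>base q j\<close> without the linear factors of the Chebyshev
  bound.\<close>

definition weight :: "nat \<Rightarrow> nat \<Rightarrow> real" where
  "weight q j =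
    (if j \<le> q then r\<^sub>1 ^ j * (1 / 4) ^ (3 * (q - j))
     else if j \<le> 2 * q then r\<^sub>1 ^ (2 * q - j) * r\<^sub>2 ^ (j - q)
     else r\<^sub>2 ^ (3 * q - j) * r\<^sub>3 ^ (3 * (j - 2 * q)))"

lemma lead_base:
  assumes "j \<le> 3 * q"
  shows "lead_form (base q j) (3 * q) j (3 * q)"
proof -
  note c = lead_form_cheb[OF lead(1)] lead_form_cheb[OF lead(2)]
    lead_form_cheb[OF lead_XW(1)] lead_form_cheb[OF lead_XW(2)]
  have le: "lead_form f a b d \<Longrightarrow> d \<le> d' \<Longrightarrow> lead_form f a b d'" for f a b d d'
    by (auto simp: lead_form_def intro: order.trans)
  consider "j \<le> q" | "q < j" "j \<le> 2 * q" | "2 * q < j" by linarith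
  then show ?thesis
  proof cases
    case 1
    then have "j * 3 + 3 * (q - j) = 3 * q" by simp
    then show ?thesis
      using 1 le[OF lead_form_mult[OF c(1)[of "r\<^sub>1\<^sup>2" j] c(3)[of "(1 / 4)\<^sup>2" "3 * (q - j)"]], of "3 * q"]
      by (simp add: base_def)
  next
    case 2
    then have "(2 * q - j) * 3 + (j - q) * 3 = 3 * q" "(2 * q - j) + (j - q) * 2 = j" by simp_all
    then show ?thesis
      using 2 lead_form_mult[OF c(1)[of "r\<^sub>1\<^sup>2" "2 * q - j"] c(2)[of "r\<^sub>2\<^sup>2" "j - q"]]
      by (simp add: base_def)
  next
    case 3
    then have "(3 * q - j) * 3 + 3 * (j - 2 * q) = 3 * q" "(3 * q - j) * 2 + 3 * (j - 2 * q) = j"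
      using assms by simp_all
    then show ?thesis
      using 3 lead_form_mult[OF c(2)[of "r\<^sub>2\<^sup>2" "3 * q - j"] c(4)[of "r\<^sub>3\<^sup>2" "3 * (j - 2 * q)"]]
      by (simp add: base_def)
  qed
qed

lemma weight_bounds: "0 < weight q j" "weight q j \<le> 1"
  using r by (auto simp: weight_def intro!: mult_le_one power_le_one)

lemma base_bound:
  assumes "(x, y) \<in> K" "j \<le> 3 * q"
  shows "\<bar>eval2 (base q j) x y\<bar> \<le> (real (3 * q + 1))\<^sup>2 * weight q j"
proof -
  define c where "c = real (3 * q + 1)"
  have c: "real k + 1 \<le> c" if "k \<le> 3 * q" for k
    using that by (simp add: c_def)
  have mult: "\<bar>eval2 (cheb [:[:s\<^sup>2:]:] P k * cheb [:[:s'\<^sup>2:]:] P' k') x y\<bar> \<le> c\<^sup>2 * (s ^ k * s' ^ k')"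
    if "\<bar>eval2 P x y\<bar> \<le> 2 * s" "\<bar>eval2 P' x y\<bar> \<le> 2 * s'" "k \<le> 3 * q" "k' \<le> 3 * q" "0 < s" "0 < s'"
    for P P' s s' k k'
  proof -
    have "\<bar>eval2 (cheb [:[:s\<^sup>2:]:] P k * cheb [:[:s'\<^sup>2:]:] P' k') x y\<bar>
        \<le> ((real k + 1) * s ^ k) * ((real k' + 1) * s' ^ k')"
      unfolding eval2_simps abs_mult using that by (intro mult_mono abs_eval2_cheb_le) auto
    also have "\<dots> \<le> (c * s ^ k) * (c * s' ^ k')"
      using that c[of k] c[of k'] by (intro mult_mono) auto
    finally show ?thesis by (simp add: power2_eq_square mult_ac)
  qed
  consider "j \<le> q" | "q < j" "j \<le> 2 * q" | "2 * q < j" by linarith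
  then have "\<bar>eval2 (base q j) x y\<bar> \<le> c\<^sup>2 * weight q j"
    using mult[OF bound(1)[OF assms(1)] bound_XW(1)[OF assms(1)], of j "3 * (q - j)"]
      mult[OF bound(1)[OF assms(1)] bound(2)[OF assms(1)], of "2 * q - j" "j - q"]
      mult[OF bound(2)[OF assms(1)] bound_XW(2)[OF assms(1)], of "3 * q - j" "3 * (j - 2 * q)"]
      assms(2) r
    by cases (simp_all add: base_def weight_def del: eval2_simps)
  then show ?thesis by (simp only: c_def)
qed

text \<open>The exponents are triangular numbers; squaring clears their denominators. The surplus
  linear in \<open>q\<close> is dropped, since the bases are at most 1.\<close>

lemma prod_weight:
  "(\<Prod>j<3 * q + 1. weight q j)\<^sup>2 \<le> ((1 / 4) ^ 3 * r\<^sub>1\<^sup>2 * r\<^sub>2\<^sup>2 * r\<^sub>3 ^ 3) ^ q\<^sup>2"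
proof -
  let ?s = "\<Sum>i<q. i" and ?S = "\<Sum>i<Suc q. i"
  have rev: "(\<Sum>i<n. n - Suc i) = (\<Sum>i<n. i)" for n :: nat
    by (rule sum.nat_diff_reindex)
  have rev': "(\<Sum>i<Suc q. q - i) = ?S" using rev[of "Suc q"] by simp
  have up: "(\<Sum>i<n. Suc i) = (\<Sum>i<Suc n. i)" for n
    by (induction n) simp_all
  have split: "3 * q + 1 = Suc q + q + q" by simp
  have "(\<Prod>j<3 * q + 1. weight q j) = (\<Prod>j<Suc q. weight q j) * (\<Prod>i<q. weight q (Suc q + i))
      * (\<Prod>i<q. weight q (Suc q + q + i))"
    unfolding split prod_lessThan_add ..
  also have "(\<Prod>j<Suc q. weight q j) = (\<Prod>j<Suc q. r\<^sub>1 ^ j * (1 / 4) ^ (3 * (q - j)))"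
    by (intro prod.cong) (auto simp: weight_def)
  also have "\<dots> = r\<^sub>1 ^ ?S * (1 / 4) ^ (3 * ?S)"
    unfolding prod.distrib power_sum[symmetric] sum_distrib_left[symmetric] rev' ..
  also have "(\<Prod>i<q. weight q (Suc q + i)) = (\<Prod>i<q. r\<^sub>1 ^ (q - Suc i) * r\<^sub>2 ^ Suc i)"
    by (intro prod.cong) (auto simp: weight_def)
  also have "\<dots> = r\<^sub>1 ^ ?s * r\<^sub>2 ^ ?S"
    unfolding prod.distrib power_sum[symmetric] rev up ..
  also have "(\<Prod>i<q. weight q (Suc q + q + i)) = (\<Prod>i<q. r\<^sub>2 ^ (q - Suc i) * r\<^sub>3 ^ (3 * Suc i))"
    by (intro prod.cong) (auto simp: weight_def)
  also have "\<dots> = r\<^sub>2 ^ ?s * r\<^sub>3 ^ (3 * ?S)"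
    unfolding prod.distrib power_sum[symmetric] sum_distrib_left[symmetric] rev up ..
  finally have "(\<Prod>j<3 * q + 1. weight q j)\<^sup>2
      = (1 / 4) ^ (2 * (3 * ?S)) * r\<^sub>1 ^ (2 * ?S + 2 * ?s) * r\<^sub>2 ^ (2 * ?S + 2 * ?s) * r\<^sub>3 ^ (2 * (3 * ?S))"
    by (simp only: power_mult_distrib power_even_eq power_add mult_ac)
  also have "2 * ?S + 2 * ?s = 2 * q\<^sup>2"
    using sum_lessThan_double[of q] by (simp add: power2_eq_square algebra_simps)
  also have "2 * (3 * ?S) = 3 * (q\<^sup>2 + q)"
    using sum_lessThan_double[of q] by (simp add: power2_eq_square algebra_simps)
  also have "(1 / 4) ^ (3 * (q\<^sup>2 + q)) * r\<^sub>1 ^ (2 * q\<^sup>2) * r\<^sub>2 ^ (2 * q\<^sup>2) * r\<^sub>3 ^ (3 * (q\<^sup>2 + q))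
      \<le> (1 / 4) ^ (3 * q\<^sup>2) * r\<^sub>1 ^ (2 * q\<^sup>2) * r\<^sub>2 ^ (2 * q\<^sup>2) * r\<^sub>3 ^ (3 * q\<^sup>2)"
    using r power_decreasing[of "3 * q\<^sup>2" "3 * (q\<^sup>2 + q)" "1 / 4 :: real"]
      power_decreasing[of "3 * q\<^sup>2" "3 * (q\<^sup>2 + q)" r\<^sub>3]
    by (intro mult_mono[OF mult_right_mono[OF mult_right_mono]] mult_nonneg_nonneg zero_le_power) auto
  finally show ?thesis
    by (simp only: power_mult power_mult_distrib)
qed

text \<open>Rounding down ensures \<open>3 * q \<le> m - 1\<close>. The missing powers of
  \<open>x\<close> and \<open>y\<close> come from monomials, which are at most 1 on
  \<open>K\<close>.\<close>

definition edge_bound :: "nat \<Rightarrow> nat \<Rightarrow> real" where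
  "edge_bound m j = (let q = (m - 1) div 3 in (real m)\<^sup>2 * weight q (min j (3 * q)))"

text \<open>The \<open>y\<close>-degree stays below \<open>m\<close>, so the polynomials of the two edges of a square of exponents do
  not interfere.\<close>

lemma edge_poly:
  assumes "j < m"
  shows "\<exists>f. lead_form f m j (m - 1) \<and> (\<forall>(x, y) \<in> K. \<bar>eval2 f x y\<bar> \<le> edge_bound m j)"
proof -
  define q i where "q = (m - 1) div 3" and "i = min j (3 * q)"
  have q: "3 * q + 1 \<le> m" and i: "i \<le> 3 * q" "i \<le> j"
    using assms by (auto simp: q_def i_def)
  define f where "f = base q i * [:0, 1:] ^ (m - 3 * q) * [:[:0, 1:]:] ^ (j - i)"
  have "lead_form [:0, 1:] 1 0 0" "lead_form [:[:0, 1:]:] 0 1 1"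
    by (auto simp: lead_form_def coeff_pCons split: nat.split)
  note this[THEN lead_form_power]
  from lead_form_mult[OF lead_form_mult[OF lead_base[OF i(1)] this(1)] this(2), of "m - 3 * q" "j - i"]
  have "lead_form f m j (3 * q + (j - i))"
    using q i by (simp add: f_def)
  moreover have "3 * q + (j - i) \<le> m - 1"
    using assms q by (auto simp: i_def min_def)
  ultimately have "lead_form f m j (m - 1)"
    by (auto simp: lead_form_def intro: order.trans)
  moreover have "\<bar>eval2 f x y\<bar> \<le> edge_bound m j" if "(x, y) \<in> K" for x y
  proof -
    have "\<bar>eval2 f x y\<bar> = \<bar>eval2 (base q i) x y\<bar> * (x ^ (m - 3 * q) * y ^ (j - i))"
      using K[OF that] by (simp add: f_def abs_mult)
    also have "\<dots> \<le> \<bar>eval2 (base q i) x y\<bar> * 1"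
      using K[OF that] by (intro mult_left_mono mult_le_one power_le_one) auto
    also have "\<dots> \<le> (real (3 * q + 1))\<^sup>2 * weight q i"
      using base_bound[OF that i(1)] by simp
    also have "\<dots> \<le> (real m)\<^sup>2 * weight q i"
      using q weight_bounds(1)[of q i] by (intro mult_right_mono power_mono) (auto simp del: of_nat_add)
    finally show ?thesis
      by (simp add: edge_bound_def Let_def q_def i_def)
  qed
  ultimately show ?thesis by blast
qed

lemma edge_bound_nonneg: "0 \<le> edge_bound m j"
  using weight_bounds(1) by (simp add: edge_bound_def Let_def less_imp_le)

text \<open>Indices \<open>j\<close> beyond \<open>3 * q\<close> have weight at most 1, so only the
  complete range counted by \<open>prod_weight\<close> is kept.\<close>

lemma prod_edge_bound:
  "(\<Prod>j<m. edge_bound m j)\<^sup>2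
    \<le> real m ^ (4 * m) * ((1 / 4) ^ 3 * r\<^sub>1\<^sup>2 * r\<^sub>2\<^sup>2 * r\<^sub>3 ^ 3) ^ ((m - 1) div 3)\<^sup>2"
proof (cases "m = 0")
  case False
  define q where "q = (m - 1) div 3"
  define w where "w = (\<lambda>j. weight q (min j (3 * q)))"
  have m: "m = (3 * q + 1) + (m - (3 * q + 1))"
    using False by (simp add: q_def)
  have w: "0 \<le> w j" "w j \<le> 1" for j
    using weight_bounds[of q "min j (3 * q)"] by (auto simp: w_def)
  have "(\<Prod>j<m. edge_bound m j) = real m ^ (2 * m) * (\<Prod>j<m. w j)"
    by (simp add: edge_bound_def Let_def prod.distrib w_def q_def power_mult[symmetric])
  also have "(\<Prod>j<m. w j) = (\<Prod>j<3 * q + 1. w j) * (\<Prod>i<m - (3 * q + 1). w (3 * q + 1 + i))"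
    by (subst m) (rule prod_lessThan_add)
  also have "\<dots> \<le> (\<Prod>j<3 * q + 1. w j) * 1"
    using w by (intro mult_left_mono prod_le_1 prod_nonneg) auto
  also have "(\<Prod>j<3 * q + 1. w j) * 1 = (\<Prod>j<3 * q + 1. weight q j)"
    by (simp del: prod.lessThan_Suc add: w_def)
  finally have le: "(\<Prod>j<m. edge_bound m j) \<le> real m ^ (2 * m) * (\<Prod>j<3 * q + 1. weight q j)"
    by (simp add: mult_left_mono)
  have "(\<Prod>j<m. edge_bound m j)\<^sup>2 \<le> (real m ^ (2 * m) * (\<Prod>j<3 * q + 1. weight q j))\<^sup>2"
    by (intro power_mono le prod_nonneg ballI edge_bound_nonneg)
  also have "\<dots> = real m ^ (4 * m) * (\<Prod>j<3 * q + 1. weight q j)\<^sup>2"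
    by (simp add: power_mult_distrib flip: power_mult)
  also have "\<dots> \<le> real m ^ (4 * m) * ((1 / 4) ^ 3 * r\<^sub>1\<^sup>2 * r\<^sub>2\<^sup>2 * r\<^sub>3 ^ 3) ^ q\<^sup>2"
    by (intro mult_left_mono prod_weight) simp
  finally show ?thesis by (simp only: q_def)
qed simp

end

section \<open>The determinant and a triangular change of basis\<close>

text \<open>In the Leibniz formula for \<open>det T\<close> only the identity contributes, so no ordering of the columns
  is needed.\<close>

lemma det_unitriangular:
  fixes T :: "'a::comm_ring_1 mat" and rk :: "nat \<Rightarrow> nat"
  assumes T: "T \<in> carrier_mat N N"
    and diag: "\<And>k. k < N \<Longrightarrow> T $$ (k, k) = 1"
    and lower: "\<And>l k. l < N \<Longrightarrow> k < N \<Longrightarrow> T $$ (l, k) \<noteq> 0 \<Longrightarrow> l = k \<or> rk l < rk k"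
  shows "det T = 1"
proof -
  have zero: "(\<Prod>i = 0..<N. T $$ (i, p i)) = 0" if p: "p permutes {0..<N}" "p \<noteq> id" for p
  proof (rule ccontr)
    assume "(\<Prod>i = 0..<N. T $$ (i, p i)) \<noteq> 0"
    then have nz: "T $$ (i, p i) \<noteq> 0" if "i < N" for i
      using that prod_zero[of "{0..<N}" "\<lambda>i. T $$ (i, p i)"]
      by (metis atLeastLessThan_iff finite_atLeastLessThan zero_le)
    have pN: "p i < N" if "i < N" for i
      using permutes_in_image[OF p(1), of i] that by simp
    obtain j where j: "p j \<noteq> j" using p(2) by (auto simp: fun_eq_iff)
    then have jN: "j < N" using p(1) by (auto simp: permutes_def)
    \<comment> \<open>If all factors are nonzero, \<open>p\<close> never lowers \<open>rk\<close>
      and raises it at \<open>j\<close>, yet a permutation preserves the sum of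
      \<open>rk\<close>.\<close>
    have "(\<Sum>i = 0..<N. rk i) < (\<Sum>i = 0..<N. rk (p i))"
    proof (rule sum_strict_mono_ex1)
      show "\<forall>i\<in>{0..<N}. rk i \<le> rk (p i)"
        using lower nz pN by (metis atLeastLessThan_iff less_imp_le order_refl)
      show "\<exists>i\<in>{0..<N}. rk i < rk (p i)"
        using lower[OF jN pN[OF jN] nz[OF jN]] j jN by auto
    qed simp
    then show False
      using sum.permute[OF p(1), of rk] by (simp add: comp_def)
  qed
  have "det T = (\<Sum>p\<in>{p. p permutes {0..<N}}. signof p * (\<Prod>i = 0..<N. T $$ (i, p i)))"
    using T by (rule det_def')
  also have "\<dots> = (\<Sum>p\<in>{id}. signof p * (\<Prod>i = 0..<N. T $$ (i, p i)))"
    by (rule sum.mono_neutral_right) (auto simp: finite_permutations permutes_id zero)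
  finally show ?thesis
    using diag by simp
qed

lemma norm_det_le:
  fixes A :: "complex mat"
  assumes A: "A \<in> carrier_mat N N" and B: "\<And>i k. i < N \<Longrightarrow> k < N \<Longrightarrow> cmod (A $$ (i, k)) \<le> B k"
  shows "cmod (det A) \<le> fact N * (\<Prod>k<N. B k)"
proof -
  let ?P = "{p. p permutes {0..<N}}"
  have term_le: "cmod (signof p * (\<Prod>i = 0..<N. A $$ (i, p i))) \<le> (\<Prod>k<N. B k)" if p: "p permutes {0..<N}" for p
  proof -
    have "cmod (signof p * (\<Prod>i = 0..<N. A $$ (i, p i))) = (\<Prod>i = 0..<N. cmod (A $$ (i, p i)))"
      by (auto simp: norm_mult prod_norm sign_def)
    also have "\<dots> \<le> (\<Prod>i = 0..<N. B (p i))"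
      using permutes_in_image[OF p] by (intro prod_mono) (auto intro!: B)
    also have "\<dots> = (\<Prod>k<N. B k)"
      using prod.permute[OF p, of B] by (simp add: comp_def atLeast0LessThan)
    finally show ?thesis .
  qed
  have "cmod (det A) \<le> (\<Sum>p\<in>?P. cmod (signof p * (\<Prod>i = 0..<N. A $$ (i, p i))))"
    unfolding det_def'[OF A] by (rule norm_sum)
  also have "\<dots> \<le> (\<Sum>p\<in>?P. (\<Prod>k<N. B k))"
    by (intro sum_mono term_le) simp
  also have "\<dots> = fact N * (\<Prod>k<N. B k)"
    using card_permutations[of "{0..<N}" N] by simp
  finally show ?thesis .
qed

text \<open>Exponents are listed by growing squares \<open>max i j\<close>; in each square first the edge \<open>j = max\<close>, then
  the edge \<open>i = max\<close>, with the corner last.\<close>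

definition rank :: "nat \<Rightarrow> nat \<Rightarrow> nat" where
  "rank i j = (if i < j then j\<^sup>2 + i else i\<^sup>2 + i + j)"

text \<open>\<open>c\<close> lists the coefficients of a polynomial with lead
  \<open>u^i v^j\<close>. The bound is asked for every large enough box, so that it does not refer
  to a matrix size.\<close>

definition shell_poly :: "(real \<times> real) set \<Rightarrow> nat \<Rightarrow> nat \<Rightarrow> real \<Rightarrow> bool" where
  "shell_poly S i j B \<longleftrightarrow> (\<exists>c. c i j = 1 \<and>
     (\<forall>a b. c a b \<noteq> 0 \<longrightarrow> a = i \<and> b = j \<or> rank a b < rank i j) \<and>
     (\<forall>n > max i j. \<forall>u v. (u, v) \<in> S \<longrightarrow> \<bar>\<Sum>a<n. \<Sum>b<n. c a b * u ^ a * v ^ b\<bar> \<le> B))"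

lemma div_mod_block:
  "a * n \<le> l \<Longrightarrow> l < a * n + n \<Longrightarrow> l div n = a \<and> l mod n = l - a * n" for a l n :: nat
  using div_nat_eqI[of n a l] by (auto simp: mult.commute modulo_nat_def)

lemma sum_div_mod:
  fixes f :: "nat \<Rightarrow> nat \<Rightarrow> 'a::comm_monoid_add"
  shows "(\<Sum>l<n\<^sup>2. f (l div n) (l mod n)) = (\<Sum>a<n. \<Sum>b<n. f a b)"
proof -
  have "(\<Sum>l<n\<^sup>2. f (l div n) (l mod n)) = (\<Sum>a<n. \<Sum>l = a * n..<a * n + n. f (l div n) (l mod n))"
    by (simp add: sum.nat_group power2_eq_square)
  moreover have "(\<Sum>l = a * n..<a * n + n. f (l div n) (l mod n)) = (\<Sum>b<n. f a b)" for a
    by (rule sum.reindex_bij_witness[of _ "\<lambda>b. a * n + b" "\<lambda>l. l - a * n"])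
      (auto simp: div_mod_block)
  ultimately show ?thesis by simp
qed

lemma prod_div_mod:
  fixes f :: "nat \<Rightarrow> nat \<Rightarrow> 'a::comm_monoid_mult"
  shows "(\<Prod>l<n\<^sup>2. f (l div n) (l mod n)) = (\<Prod>a<n. \<Prod>b<n. f a b)"
proof -
  have "(\<Prod>l<n\<^sup>2. f (l div n) (l mod n)) = (\<Prod>a<n. \<Prod>l = a * n..<a * n + n. f (l div n) (l mod n))"
    by (simp add: prod.nat_group power2_eq_square)
  moreover have "(\<Prod>l = a * n..<a * n + n. f (l div n) (l mod n)) = (\<Prod>b<n. f a b)" for a
    by (rule prod.reindex_bij_witness[of _ "\<lambda>b. a * n + b" "\<lambda>l. l - a * n"])
      (auto simp: div_mod_block)
  ultimately show ?thesis by simp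
qed

text \<open>Column \<open>k\<close> of \<open>T\<close> holds the coefficients of the polynomial for
  exponent \<open>k\<close>. Hence \<open>?A * T\<close> contains its values at the points, while
  \<open>det T = 1\<close> leaves the determinant unchanged.\<close>

lemma rec_sup_det_le:
  assumes "\<And>i j. i < n \<Longrightarrow> j < n \<Longrightarrow> shell_poly S i j (B i j)"
  shows "rec_sup_det n (real_to_C2 S) \<le> ennreal (fact (n\<^sup>2) * (\<Prod>i<n. \<Prod>j<n. B i j))"
proof -
  define P where "P i j c \<longleftrightarrow> c i j = 1 \<and>
     (\<forall>a b. c a b \<noteq> 0 \<longrightarrow> a = i \<and> b = j \<or> rank a b < rank i j) \<and>
     (\<forall>n > max i j. \<forall>u v. (u, v) \<in> S \<longrightarrow> \<bar>\<Sum>a<n. \<Sum>b<n. c a b * u ^ a * v ^ b\<bar> \<le> B i j)" for i j c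
  have "\<forall>i j. \<exists>c. i < n \<longrightarrow> j < n \<longrightarrow> P i j c"
    using assms unfolding shell_poly_def P_def by blast
  then obtain c where P: "\<And>i j. i < n \<Longrightarrow> j < n \<Longrightarrow> P i j (c i j)"
    by metis
  then have c: "\<And>i j. i < n \<Longrightarrow> j < n \<Longrightarrow> c i j i j = 1"
      "\<And>i j a b. i < n \<Longrightarrow> j < n \<Longrightarrow> c i j a b \<noteq> 0 \<Longrightarrow> a = i \<and> b = j \<or> rank a b < rank i j"
      "\<And>i j u v. i < n \<Longrightarrow> j < n \<Longrightarrow> (u, v) \<in> S \<Longrightarrow> \<bar>\<Sum>a<n. \<Sum>b<n. c i j a b * u ^ a * v ^ b\<bar> \<le> B i j"
    unfolding P_def by simp_all
  let ?N = "n\<^sup>2"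
  have dm: "k div n < n" "k mod n < n" if "k < ?N" for k
  proof -
    have "n > 0" using that by (cases n) auto
    then show "k div n < n" "k mod n < n"
      using that by (simp_all add: less_mult_imp_div_less power2_eq_square)
  qed
  define T where "T = mat ?N ?N (\<lambda>(l, k). complex_of_real (c (k div n) (k mod n) (l div n) (l mod n)))"
  have T: "T \<in> carrier_mat ?N ?N" by (simp add: T_def)
  have "det T = 1"
  proof (rule det_unitriangular[OF T, where rk = "\<lambda>k. rank (k div n) (k mod n)"])
    fix l k assume "l < ?N" "k < ?N" "T $$ (l, k) \<noteq> 0"
    then show "l = k \<or> rank (l div n) (l mod n) < rank (k div n) (k mod n)"
      using c(2)[of "k div n" "k mod n" "l div n" "l mod n"] dm[of k]
      by (auto simp: T_def) (metis div_mult_mod_eq)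
  qed (use c(1) dm in \<open>simp add: T_def\<close>)
  have "cmod (det (rec_matrix n z)) \<le> fact ?N * (\<Prod>i<n. \<Prod>j<n. B i j)"
    if z: "z \<in> {..<?N} \<rightarrow>\<^sub>E real_to_C2 S" for z
  proof -
    let ?A = "rec_matrix n z"
    have A: "?A \<in> carrier_mat ?N ?N" by (simp add: rec_matrix_def)
    have "cmod ((?A * T) $$ (i, k)) \<le> B (k div n) (k mod n)" if ik: "i < ?N" "k < ?N" for i k
    proof -
      have "z i \<in> real_to_C2 S" using z ik(1) by (auto simp: PiE_def)
      then obtain u v where uv: "(u, v) \<in> S" "z i = (complex_of_real u, complex_of_real v)"
        unfolding real_to_C2_def by auto
      let ?f = "\<lambda>a b. c (k div n) (k mod n) a b * u ^ a * v ^ b"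
      have "(?A * T) $$ (i, k) = (\<Sum>l<?N. ?A $$ (i, l) * T $$ (l, k))"
        using ik A T by (simp add: scalar_prod_def lessThan_atLeast0)
      also have "\<dots> = (\<Sum>l<?N. complex_of_real (?f (l div n) (l mod n)))"
        using ik by (intro sum.cong) (auto simp: rec_matrix_def rec_monom_def T_def uv)
      also have "\<dots> = complex_of_real (\<Sum>a<n. \<Sum>b<n. ?f a b)"
        unfolding sum_div_mod[of "\<lambda>a b. complex_of_real (?f a b)"] by simp
      finally have "cmod ((?A * T) $$ (i, k)) = \<bar>\<Sum>a<n. \<Sum>b<n. ?f a b\<bar>"
        by (simp only: norm_of_real)
      then show ?thesis
        using c(3)[OF dm[OF ik(2)] uv(1)] by simp
    qed
    then have "cmod (det (?A * T)) \<le> fact ?N * (\<Prod>k<?N. B (k div n) (k mod n))"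
      using A T by (intro norm_det_le) auto
    then show ?thesis
      using det_mult[OF A T] \<open>det T = 1\<close> by (simp add: prod_div_mod)
  qed
  then show ?thesis
    unfolding rec_sup_det_def by (intro SUP_least ennreal_leI)
qed

text \<open>The exponents with maximum \<open>m\<close> have ranks from \<open>m^2\<close> to
  \<open>(m + 1)^2 - 1\<close>.\<close>

lemma rank_less: "max a b < max i j \<Longrightarrow> rank a b < rank i j"
proof -
  assume *: "max a b < max i j"
  have "rank a b < (max a b + 1)\<^sup>2"
    by (auto simp: rank_def max_def power2_eq_square)
  also have "\<dots> \<le> (max i j)\<^sup>2"
    using * by (intro power_mono) auto
  also have "\<dots> \<le> rank i j"
    by (auto simp: rank_def max_def)
  finally show ?thesis .
qed

text \<open>The bare monomial suffices: only \<open>n\<close> of the \<open>n^2\<close> exponents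
  are corners.\<close>

lemma shell_poly_corner:
  assumes "\<And>u v. (u, v) \<in> S \<Longrightarrow> 0 \<le> u \<and> u \<le> 1 \<and> 0 \<le> v \<and> v \<le> 1"
  shows "shell_poly S m m 1"
  unfolding shell_poly_def
proof (intro exI[of _ "\<lambda>a b. if a = m \<and> b = m then 1 else 0"] conjI allI impI ballI)
  fix n u v assume n: "n > max m m" and uv: "(u, v) \<in> S"
  have "(if a = m \<and> b = m then 1 else 0) * u ^ a * v ^ b = (if b = m then (if a = m then u ^ m * v ^ m else 0) else 0)"
    for a b by simp
  then have "(\<Sum>a<n. \<Sum>b<n. (if a = m \<and> b = m then 1 else 0) * u ^ a * v ^ b) = u ^ m * v ^ m"
    using n by (simp add: sum.delta)
  then show "\<bar>\<Sum>a<n. \<Sum>b<n. (if a = m \<and> b = m then 1 else 0) * u ^ a * v ^ b\<bar> \<le> 1"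
    using assms[OF uv] by (auto simp: abs_mult intro!: mult_le_one power_le_one)
qed (auto split: if_splits)

text \<open>With \<open>y\<close>-degree below \<open>m\<close>, every other monomial lies earlier
  on the same edge or in a smaller square.\<close>

lemma lead_form_shell:
  assumes f: "lead_form f m j (m - 1)" and "j < m"
  shows "coeff (coeff f m) j = 1" "degree f < Suc m" "degree (coeff f i) < m"
    and "coeff (coeff f a) b \<noteq> 0 \<Longrightarrow> a = m \<and> b = j \<or> a = m \<and> b < j \<or> a < m \<and> b < m"
proof -
  show "coeff (coeff f m) j = 1" "degree f < Suc m" and d: "degree (coeff f i) < m" for i
    using assms by (auto simp: lead_form_def le_imp_less_Suc intro: le_less_trans)
  assume nz: "coeff (coeff f a) b \<noteq> 0"
  then have "coeff f a \<noteq> 0" by auto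
  then have "a \<le> m" using f le_degree[of f a] by (auto simp: lead_form_def)
  moreover have "b < m" using le_degree[OF nz] d[of a] by simp
  moreover have "b \<le> j" if "a = m" using le_degree[OF nz] f that by (auto simp: lead_form_def)
  ultimately show "a = m \<and> b = j \<or> a = m \<and> b < j \<or> a < m \<and> b < m" by linarith
qed

lemma shell_poly_first:
  assumes "lead_form f m j (m - 1)" "j < m" "\<forall>(u, v) \<in> S. \<bar>eval2 f u v\<bar> \<le> B"
  shows "shell_poly S m j B"
  unfolding shell_poly_def
proof (intro exI[of _ "\<lambda>a b. coeff (coeff f a) b"] conjI allI impI ballI)
  note f = lead_form_shell[OF assms(1,2)]
  fix a b assume "coeff (coeff f a) b \<noteq> 0"
  from f(4)[OF this] show "a = m \<and> b = j \<or> rank a b < rank m j"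
    using assms(2) rank_less[of a b m j] by (auto simp: rank_def)
next
  note f = lead_form_shell[OF assms(1,2)]
  fix n u v assume n: "n > max m j" and uv: "(u, v) \<in> S"
  have "degree f < n" "degree (coeff f i) < n" for i
    using n f(2) f(3)[of i] by linarith+
  then show "\<bar>\<Sum>a<n. \<Sum>b<n. coeff (coeff f a) b * u ^ a * v ^ b\<bar> \<le> B"
    using assms(3) uv eval2_as_sum[of f n u v] by auto
qed (rule lead_form_shell[OF assms(1,2)])

text \<open>On this edge \<open>v\<close> is the leading variable, so the coefficients are
  transposed.\<close>

lemma shell_poly_second:
  assumes "lead_form f m j (m - 1)" "j < m" "\<forall>(u, v) \<in> S. \<bar>eval2 f v u\<bar> \<le> B"
  shows "shell_poly S j m B"
  unfolding shell_poly_def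
proof (intro exI[of _ "\<lambda>a b. coeff (coeff f b) a"] conjI allI impI ballI)
  note f = lead_form_shell[OF assms(1,2)]
  fix a b assume "coeff (coeff f b) a \<noteq> 0"
  from f(4)[OF this] show "a = j \<and> b = m \<or> rank a b < rank j m"
    using assms(2) rank_less[of a b j m] by (auto simp: rank_def)
next
  note f = lead_form_shell[OF assms(1,2)]
  fix n u v assume n: "n > max j m" and uv: "(u, v) \<in> S"
  have "degree f < n" "degree (coeff f i) < n" for i
    using n f(2) f(3)[of i] by linarith+
  then have "eval2 f v u = (\<Sum>b<n. \<Sum>a<n. coeff (coeff f b) a * v ^ b * u ^ a)"
    by (rule eval2_as_sum)
  also have "\<dots> = (\<Sum>a<n. \<Sum>b<n. coeff (coeff f b) a * u ^ a * v ^ b)"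
    by (subst sum.swap) (simp add: mult_ac)
  finally show "\<bar>\<Sum>a<n. \<Sum>b<n. coeff (coeff f b) a * u ^ a * v ^ b\<bar> \<le> B"
    using assms(3) uv by auto
qed (rule lead_form_shell[OF assms(1,2)])

section \<open>Four polynomials with small supremum\<close>

definition poly_of_table :: "real \<Rightarrow> int list list \<Rightarrow> real poly poly" where
  "poly_of_table s p = Poly (map (\<lambda>r. Poly (map (\<lambda>c. real_of_int c / s) r)) p)"

lemma eval2_poly_of_table: "eval2 (poly_of_table s p) x y = table_eval p x y / s"
proof -
  have row: "poly (Poly (map (\<lambda>c. real_of_int c / s) r)) y = row_eval r y 1 / s" for r
    by (induction r) (simp_all add: add_divide_distrib)
  show ?thesis
    by (induction p) (simp_all add: poly_of_table_def table_eval_def row add_divide_distrib)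
qed

lemma abs_table_eval_le:
  assumes "table_cert c p" "table_cert c (map (map uminus) p)" "length p = 4" "\<forall>r \<in> set p. length r = 4"
    and "0 \<le> v" "v \<le> 1" "0 \<le> u" "u \<le> ((v - 1) / (v + 1))\<^sup>2"
  shows "\<bar>table_eval p u v\<bar> \<le> c"
proof -
  have "table_eval (map (map uminus) p) u v = - table_eval p u v"
    unfolding table_eval_def by (induction p) (simp_all add: row_eval_uminus del: map_map)
  then show ?thesis
    using table_cert_sound[OF assms(1,3-)] table_cert_sound[OF assms(2) _ _ assms(5-)] assms(3,4) by simp
qed

text \<open>Rounded coefficients, in units of \<open>1 / 10\<^sup>5\<close> and \<open>1 / 10\<^sup>6\<close>, of polynomials with nearly minimal
  supremum on the region among those with the given lead; they come from linear programming. The rows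
  of the last two tables belong to the powers of \<open>v\<close>, hence the transposition below.\<close>

definition table_u31 :: "int list list" where
  "table_u31 = [[-26, -629, 2016, -1444], [-724, 40968, -152895, 136521],
     [2625, -137604, 319576, -71467], [-1958, 100000, 0, 0]]"

definition table_u32 :: "int list list" where
  "table_u32 = [[65, -1533, 3985, -2501], [-1267, 29437, -3140, -74078],
     [2722, -2409, -860452, 1339187], [-1412, -44600, 1000000, 0]]"

definition table_v31 :: "int list list" where
  "table_v31 = [[-35, -276, 1300, -1040], [570, 17231, -62526, 49037],
     [-1271, -93022, 213179, -111944], [688, 100000, 0, 0]]"

definition table_v32 :: "int list list" where
  "table_v32 = [[76, -942, 1735, -794], [-1311, 23028, -4609, -28775],
     [3373, -43539, -508753, 607381], [-2169, -4461, 1000000, 0]]"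

lemmas table_defs = table_u31_def table_u32_def table_v31_def table_v32_def

text \<open>The constants here and in the next three lemmas bound the suprema in the units of the
  tables; two certificates per table cover both signs.\<close>

lemma cert_u31: "table_cert 96 table_u31" "table_cert 96 (map (map uminus) table_u31)"
  by code_simp+

lemma cert_u32: "table_cert 126 table_u32" "table_cert 126 (map (map uminus) table_u32)"
  by code_simp+

lemma cert_v31:
  "table_cert 60 (List.transpose table_v31)" "table_cert 60 (map (map uminus) (List.transpose table_v31))"
  by code_simp+

lemma cert_v32:
  "table_cert 88 (List.transpose table_v32)" "table_cert 88 (map (map uminus) (List.transpose table_v32))"
  by code_simp+

lemma lead_form_tables:
  "lead_form (poly_of_table (10 ^ 5) table_u31) 3 1 3"
  "lead_form (poly_of_table (10 ^ 6) table_u32) 3 2 3"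
  "lead_form (poly_of_table (10 ^ 5) table_v31) 3 1 3"
  "lead_form (poly_of_table (10 ^ 6) table_v32) 3 2 3"
  by (auto simp: lead_form_def poly_of_table_def table_defs coeff_pCons numeral_3_eq_3 numeral_2_eq_2
      split: nat.split)

section \<open>The region and its two edge families\<close>

definition region :: "(real \<times> real) set" where
  "region = {(u, v). 0 \<le> v \<and> v \<le> 1 \<and> 0 \<le> u \<and> u \<le> ((v - 1) / (v + 1))\<^sup>2}"

lemma region_bounds:
  assumes "(u, v) \<in> region"
  shows "0 \<le> u" "u \<le> 1" "0 \<le> v" "v \<le> 1" "u * v \<le> 91 / 1000"
proof -
  have uv: "0 \<le> v" "v \<le> 1" "0 \<le> u" "u \<le> ((v - 1) / (v + 1))\<^sup>2"
    using assms by (auto simp: region_def)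
  then show "0 \<le> u" "0 \<le> v" "v \<le> 1" by auto
  have le: "u * (v + 1)\<^sup>2 \<le> (v - 1)\<^sup>2"
    using uv by (simp add: power_divide pos_le_divide_eq)
  have "\<bar>(v - 1) / (v + 1)\<bar> \<le> 1"
    using uv by (simp add: field_simps abs_if)
  then have "((v - 1) / (v + 1))\<^sup>2 \<le> 1" by (simp add: abs_square_le_1)
  then show "u \<le> 1" using uv(4) by linarith
  \<comment> \<open>the maximum on the boundary curve is \<open>((sqrt 5 - 1) / 2)\<^sup>5 = 0.0901...\<close>, at \<open>v = sqrt 5 - 2\<close>\<close>
  have "91 / 1000 * (v + 1)\<^sup>2 - v * (v - 1)\<^sup>2
      = (v - 236 / 1000)\<^sup>2 * (1619 / 1000 - v) + 1864 / 1000000 * v + (91 / 1000 - (236 / 1000)\<^sup>2 * (1619 / 1000))"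
    by (simp add: power2_eq_square field_simps)
  also have "\<dots> \<ge> 0"
    using uv by (intro add_nonneg_nonneg mult_nonneg_nonneg) (auto simp: power2_eq_square)
  finally have "v * (v - 1)\<^sup>2 \<le> 91 / 1000 * (v + 1)\<^sup>2" by simp
  moreover have "u * v * (v + 1)\<^sup>2 \<le> v * (v - 1)\<^sup>2"
    using mult_left_mono[OF le uv(1)] by (simp add: mult_ac)
  ultimately have "u * v * (v + 1)\<^sup>2 \<le> 91 / 1000 * (v + 1)\<^sup>2" by linarith
  then show "u * v \<le> 91 / 1000"
    using uv(1) by (simp add: mult_le_cancel_right)
qed

text \<open>The first two radii are half the certified suprema; the third is a quarter of the bound
  for \<open>u * v\<close>.\<close>

interpretation first: edge_family region "poly_of_table (10 ^ 5) table_u31" "poly_of_table (10 ^ 6) table_u32"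
  "48 / 10 ^ 5" "63 / 10 ^ 6" "91 / 4000"
proof
  fix x y assume xy: "(x, y) \<in> region"
  then have "\<bar>table_eval table_u31 x y\<bar> \<le> real_of_int 96" "\<bar>table_eval table_u32 x y\<bar> \<le> real_of_int 126"
    by (auto simp: region_def table_defs intro!: abs_table_eval_le cert_u31[unfolded table_defs]
        cert_u32[unfolded table_defs] simp del: of_int_numeral)
  then show "\<bar>eval2 (poly_of_table (10 ^ 5) table_u31) x y\<bar> \<le> 2 * (48 / 10 ^ 5)"
      "\<bar>eval2 (poly_of_table (10 ^ 6) table_u32) x y\<bar> \<le> 2 * (63 / 10 ^ 6)"
    by (simp_all add: eval2_poly_of_table)
  show "0 \<le> x \<and> x \<le> 1 \<and> 0 \<le> y \<and> y \<le> 1 \<and> x * y \<le> 4 * (91 / 4000)"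
    using region_bounds[OF xy] by simp
qed (use lead_form_tables in simp_all)

text \<open>The converse relation makes \<open>v\<close> the first coordinate. The certificates
  still refer to \<open>(u, v)\<close>, hence the transposed tables.\<close>

interpretation second: edge_family "region\<inverse>" "poly_of_table (10 ^ 5) table_v31" "poly_of_table (10 ^ 6) table_v32"
  "30 / 10 ^ 5" "44 / 10 ^ 6" "91 / 4000"
proof
  fix x y assume "(x, y) \<in> region\<inverse>"
  then have yx: "(y, x) \<in> region" by simp
  have "table_eval table_v31 x y = table_eval (List.transpose table_v31) y x"
      "table_eval table_v32 x y = table_eval (List.transpose table_v32) y x"
    by (simp_all add: table_defs table_eval_def algebra_simps)
  moreover have "\<bar>table_eval (List.transpose table_v31) y x\<bar> \<le> real_of_int 60"
    using yx by (intro abs_table_eval_le cert_v31) (auto simp: region_def table_defs)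
  moreover have "\<bar>table_eval (List.transpose table_v32) y x\<bar> \<le> real_of_int 88"
    using yx by (intro abs_table_eval_le cert_v32) (auto simp: region_def table_defs)
  ultimately show "\<bar>eval2 (poly_of_table (10 ^ 5) table_v31) x y\<bar> \<le> 2 * (30 / 10 ^ 5)"
      "\<bar>eval2 (poly_of_table (10 ^ 6) table_v32) x y\<bar> \<le> 2 * (44 / 10 ^ 6)"
    by (simp_all add: eval2_poly_of_table)
  show "0 \<le> x \<and> x \<le> 1 \<and> 0 \<le> y \<and> y \<le> 1 \<and> x * y \<le> 4 * (91 / 4000)"
    using region_bounds[OF yx] by (simp add: mult.commute)
qed (use lead_form_tables in simp_all)

section \<open>The exponent count\<close>

definition basis_bound :: "nat \<Rightarrow> nat \<Rightarrow> real" where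
  "basis_bound i j = (if j < i then first.edge_bound i j else if i < j then second.edge_bound j i else 1)"

lemma shell_poly_region: "shell_poly region i j (basis_bound i j)"
proof -
  consider "j < i" | "i < j" | "i = j" by linarith
  then show ?thesis
  proof cases
    case 1
    then show ?thesis
      using first.edge_poly[OF 1] shell_poly_first[OF _ 1] by (auto simp: basis_bound_def)
  next
    case 2
    obtain f where f: "lead_form f j i (j - 1)"
        "\<forall>(x, y) \<in> region\<inverse>. \<bar>eval2 f x y\<bar> \<le> second.edge_bound j i"
      using second.edge_poly[OF 2] by blast
    then have "\<forall>(u, v) \<in> region. \<bar>eval2 f v u\<bar> \<le> second.edge_bound j i" by auto
    then show ?thesis
      using 2 shell_poly_second[OF f(1) 2] by (simp add: basis_bound_def)
  next
    case 3
    then show ?thesis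
      using region_bounds by (auto simp: basis_bound_def intro!: shell_poly_corner)
  qed
qed

lemma prod_square_shells:
  fixes f :: "nat \<Rightarrow> nat \<Rightarrow> 'a::comm_monoid_mult"
  shows "(\<Prod>i<n. \<Prod>j<n. f i j) = (\<Prod>m<n. f m m * (\<Prod>j<m. f m j) * (\<Prod>j<m. f j m))"
proof (induction n)
  case (Suc n)
  have "(\<Prod>i<Suc n. \<Prod>j<Suc n. f i j) = (\<Prod>i<n. \<Prod>j<n. f i j) * (\<Prod>i<n. f i n) * ((\<Prod>j<n. f n j) * f n n)"
    by (simp add: prod.distrib ac_simps)
  then show ?case using Suc by (simp add: ac_simps)
qed simp

text \<open>The product of the bases from \<open>prod_edge_bound\<close> for both edges. Its
  exponent grows like \<open>n^3 / 27\<close>, which explains the 27th power in the comparison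
  below.\<close>

definition \<Lambda> :: real where
  "\<Lambda> = ((1 / 4) ^ 3 * (48 / 10 ^ 5)\<^sup>2 * (63 / 10 ^ 6)\<^sup>2 * (91 / 4000) ^ 3) *
     ((1 / 4) ^ 3 * (30 / 10 ^ 5)\<^sup>2 * (44 / 10 ^ 6)\<^sup>2 * (91 / 4000) ^ 3)"

lemma \<Lambda>_bounds: "0 < \<Lambda>" "\<Lambda> \<le> 1" "\<Lambda> < 0.023 ^ 27"
  by (simp_all add: \<Lambda>_def power_divide)

lemma prod_basis_bound:
  "(\<Prod>i<n. \<Prod>j<n. basis_bound i j)\<^sup>2 \<le> real n ^ (4 * n\<^sup>2) * \<Lambda> ^ (\<Sum>m<n. ((m - 1) div 3)\<^sup>2)"
proof -
  let ?e = "\<lambda>m. ((m - 1) div 3)\<^sup>2"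
  have "(\<Prod>i<n. \<Prod>j<n. basis_bound i j)\<^sup>2
      = (\<Prod>m<n. (\<Prod>j<m. first.edge_bound m j)\<^sup>2 * (\<Prod>j<m. second.edge_bound m j)\<^sup>2)"
    unfolding prod_square_shells by (simp add: basis_bound_def prod_power_distrib power_mult_distrib)
  also have "\<dots> \<le> (\<Prod>m<n. real n ^ (8 * m) * \<Lambda> ^ ?e m)"
  proof (intro prod_mono conjI)
    fix m assume "m \<in> {..<n}"
    have eq: "real m ^ (4 * m) * real m ^ (4 * m) = real m ^ (8 * m)"
      by (simp flip: power_add)
    have "(\<Prod>j<m. first.edge_bound m j)\<^sup>2 * (\<Prod>j<m. second.edge_bound m j)\<^sup>2
        \<le> (real m ^ (4 * m) * ((1 / 4) ^ 3 * (48 / 10 ^ 5)\<^sup>2 * (63 / 10 ^ 6)\<^sup>2 * (91 / 4000) ^ 3) ^ ?e m) *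
           (real m ^ (4 * m) * ((1 / 4) ^ 3 * (30 / 10 ^ 5)\<^sup>2 * (44 / 10 ^ 6)\<^sup>2 * (91 / 4000) ^ 3) ^ ?e m)"
      by (intro mult_mono first.prod_edge_bound second.prod_edge_bound) auto
    also have "\<dots> = real m ^ (8 * m) * \<Lambda> ^ ?e m"
      unfolding eq[symmetric] \<Lambda>_def power_mult_distrib[of _ _ "?e m"]
      by (simp only: mult_ac)
    also have "\<dots> \<le> real n ^ (8 * m) * \<Lambda> ^ ?e m"
      using \<open>m \<in> {..<n}\<close> \<Lambda>_bounds by (intro mult_right_mono power_mono) auto
    finally show "(\<Prod>j<m. first.edge_bound m j)\<^sup>2 * (\<Prod>j<m. second.edge_bound m j)\<^sup>2
        \<le> real n ^ (8 * m) * \<Lambda> ^ ?e m" .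
  qed simp
  also have "\<dots> = real n ^ (8 * (\<Sum>m<n. m)) * \<Lambda> ^ (\<Sum>m<n. ?e m)"
    by (simp add: prod.distrib power_sum sum_distrib_left)
  also have "\<dots> \<le> real n ^ (4 * n\<^sup>2) * \<Lambda> ^ (\<Sum>m<n. ?e m)"
  proof (cases "n = 0")
    case False
    then have "8 * (\<Sum>m<n. m) \<le> 4 * n\<^sup>2"
      using sum_lessThan_double[of "n - 1"] by (simp add: power2_eq_square)
    then show ?thesis
      using False \<Lambda>_bounds by (intro mult_right_mono power_increasing) auto
  qed simp
  finally show ?thesis .
qed

text \<open>Summation of \<open>(m^2 - 6 * m) / 9\<close>, a lower bound for each term because
  \<open>3 * ((m - 1) div 3) \<ge> m - 3\<close>. For \<open>m < 3\<close> squaring this is not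
  allowed, but then the bound is not positive.\<close>

lemma sum_div_ge:
  "real n * (real n - 1) * ((2 * real n - 1) / 54 - 1 / 3) \<le> real (\<Sum>m<n. ((m - 1) div 3)\<^sup>2)"
proof (induction n)
  case (Suc n)
  let ?q = "(n - 1) div 3"
  have "((real n)\<^sup>2 - 6 * real n) / 9 \<le> (real ?q)\<^sup>2"
  proof (cases "3 \<le> n")
    case True
    have "n \<le> 3 * ?q + 3" by linarith
    then have "(real n - 3)\<^sup>2 \<le> (3 * real ?q)\<^sup>2"
      using True by (intro power_mono) linarith+
    then show ?thesis by (simp add: power2_eq_square algebra_simps)
  next
    case False
    then have "real n * (real n - 6) \<le> 0"
      by (intro mult_nonneg_nonpos) auto
    then have "(real n)\<^sup>2 - 6 * real n \<le> 0"
      by (simp add: power2_eq_square algebra_simps)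
    then have "((real n)\<^sup>2 - 6 * real n) / 9 \<le> 0" by simp
    also have "0 \<le> (real ?q)\<^sup>2" by simp
    finally show ?thesis .
  qed
  moreover have "real (Suc n) * (real (Suc n) - 1) * ((2 * real (Suc n) - 1) / 54 - 1 / 3)
      = real n * (real n - 1) * ((2 * real n - 1) / 54 - 1 / 3) + ((real n)\<^sup>2 - 6 * real n) / 9"
    by (simp add: power2_eq_square field_simps)
  moreover have "real (\<Sum>m<Suc n. ((m - 1) div 3)\<^sup>2) = real (\<Sum>m<n. ((m - 1) div 3)\<^sup>2) + (real ?q)\<^sup>2"
    by simp
  ultimately show ?case using Suc by linarith
qed simp

text \<open>The logarithm of the root of the final estimate: the first term collects the factorial
  and the powers of \<open>n\<close>, the second the exponent of \<open>\<Lambda>\<close>.\<close>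

definition root_exponent :: "nat \<Rightarrow> real" where
  "root_exponent n = 4 * ln (real n) / (real n - 1) +
     ln \<Lambda> / 2 * ((2 * real n - 1) / (54 * real n) - 1 / (3 * real n))"

lemma root_exponent_tendsto: "root_exponent \<longlonglongrightarrow> ln \<Lambda> / 54"
proof -
  have "(\<lambda>n. 4 * ln (real n) / (real n - 1)) \<longlonglongrightarrow> 0"
    and "(\<lambda>n. (2 * real n - 1) / (54 * real n) - 1 / (3 * real n)) \<longlonglongrightarrow> 1 / 27"
    by real_asymp+
  then have "root_exponent \<longlonglongrightarrow> 0 + ln \<Lambda> / 2 * (1 / 27)"
    unfolding root_exponent_def by (intro tendsto_add tendsto_mult_left)
  then show ?thesis by simp
qed

lemma total_bound:
  assumes "2 \<le> n"
  shows "fact (n\<^sup>2) * (\<Prod>i<n. \<Prod>j<n. basis_bound i j) \<le> exp (root_exponent n) ^ (n\<^sup>2 * (n - 1))"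
proof (rule power2_le_imp_le)
  let ?p = "\<Prod>i<n. \<Prod>j<n. basis_bound i j" and ?\<sigma> = "\<Sum>m<n. ((m - 1) div 3)\<^sup>2"
  have n: "0 < real n" "1 < real n" "real (n - 1) = real n - 1"
    using assms by (auto simp: of_nat_diff)
  have "fact (n\<^sup>2) \<le> real ((n\<^sup>2) ^ n\<^sup>2)"
    by (rule fact_le_power)
  then have "(fact (n\<^sup>2))\<^sup>2 \<le> (real ((n\<^sup>2) ^ n\<^sup>2))\<^sup>2"
    by (intro power_mono) auto
  also have "\<dots> = real n ^ (4 * n\<^sup>2)"
    by (simp flip: power_mult)
  finally have "(fact (n\<^sup>2) * ?p)\<^sup>2 \<le> real n ^ (4 * n\<^sup>2) * (real n ^ (4 * n\<^sup>2) * \<Lambda> ^ ?\<sigma>)"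
    unfolding power_mult_distrib by (intro mult_mono prod_basis_bound) auto
  also have "\<dots> = exp (real (4 * n\<^sup>2) * ln (real n) + (real (4 * n\<^sup>2) * ln (real n) + real ?\<sigma> * ln \<Lambda>))"
    unfolding exp_add exp_of_nat_mult exp_ln[OF n(1)] exp_ln[OF \<Lambda>_bounds(1)] ..
  also have "real (4 * n\<^sup>2) * ln (real n) + (real (4 * n\<^sup>2) * ln (real n) + real ?\<sigma> * ln \<Lambda>)
      = 8 * (real n)\<^sup>2 * ln (real n) + real ?\<sigma> * ln \<Lambda>"
    by simp
  \<comment> \<open>\<open>ln \<Lambda> \<le> 0\<close> turns the lower bound for the exponent sum
    into an upper bound.\<close>
  also have "exp (8 * (real n)\<^sup>2 * ln (real n) + real ?\<sigma> * ln \<Lambda>) \<le> exp (8 * (real n)\<^sup>2 * ln (real n) +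
      real n * (real n - 1) * ((2 * real n - 1) / 54 - 1 / 3) * ln \<Lambda>)"
    using sum_div_ge[of n] \<Lambda>_bounds by (simp add: mult_right_mono_neg)
  also have "8 * (real n)\<^sup>2 * ln (real n) + real n * (real n - 1) * ((2 * real n - 1) / 54 - 1 / 3) * ln \<Lambda>
      = real (2 * (n\<^sup>2 * (n - 1))) * root_exponent n"
  proof -
    define x F G where "x = real n" and "F = 4 * ln x / (x - 1)" and "G = (2 * x - 1) / (54 * x) - 1 / (3 * x)"
    have x: "real (2 * (n\<^sup>2 * (n - 1))) = 2 * (x\<^sup>2 * (x - 1))" "root_exponent n = F + ln \<Lambda> / 2 * G"
      using n(3) by (simp_all add: x_def F_def G_def root_exponent_def)
    have F: "x\<^sup>2 * (x - 1) * F = 4 * x\<^sup>2 * ln x" and G: "x * G = (2 * x - 1) / 54 - 1 / 3"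
      using n by (simp_all add: F_def G_def x_def field_simps)
    have "2 * (x\<^sup>2 * (x - 1)) * (F + ln \<Lambda> / 2 * G) = 2 * (x\<^sup>2 * (x - 1) * F) + x * (x - 1) * (x * G) * ln \<Lambda>"
      by (simp add: algebra_simps power2_eq_square)
    then show ?thesis unfolding x F G by (simp add: x_def)
  qed
  also have "exp \<dots> = (exp (root_exponent n) ^ (n\<^sup>2 * (n - 1)))\<^sup>2"
    unfolding exp_of_nat_mult power_even_eq ..
  finally show "(fact (n\<^sup>2) * ?p)\<^sup>2 \<le> (exp (root_exponent n) ^ (n\<^sup>2 * (n - 1)))\<^sup>2" .
qed simp

section \<open>Roots and the limit superior\<close>

lemma ennreal_root_le:
  fixes b :: real
  assumes "x \<le> ennreal (b ^ k)" "0 \<le> b" "0 < k"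
  shows "ennreal_root k x \<le> ennreal b"
proof -
  have "x \<noteq> \<infinity>"
    using assms(1) by (auto simp: infinity_ennreal_def top_unique)
  moreover have "root k (enn2real x) \<le> root k (b ^ k)"
    using assms enn2real_leI[of "b ^ k" x] by (intro real_root_le_mono) auto
  ultimately show ?thesis
    using assms by (simp add: ennreal_root_def real_root_power_cancel ennreal_leI)
qed

lemma sup_rec_transfinite_diameter_region:
  "sup_rec_transfinite_diameter (real_to_C2 region) \<le> ennreal (exp (ln \<Lambda> / 54))"
proof -
  let ?e = "\<lambda>n. ennreal (exp (root_exponent n))"
  have "ennreal_root (n\<^sup>2 * (n - 1)) (rec_sup_det n (real_to_C2 region)) \<le> ?e n" if "2 \<le> n" for n
    using that rec_sup_det_le[of n region basis_bound] shell_poly_region total_bound[OF that]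
    by (intro ennreal_root_le) (auto intro: order.trans ennreal_leI)
  then have "sup_rec_transfinite_diameter (real_to_C2 region) \<le> limsup ?e"
    unfolding sup_rec_transfinite_diameter_def
    by (intro Limsup_mono eventually_sequentiallyI[of 2])
  also have "limsup ?e = ennreal (exp (ln \<Lambda> / 54))"
    by (intro lim_imp_Limsup tendsto_ennrealI tendsto_exp root_exponent_tendsto) simp
  finally show ?thesis .
qed

theorem proposition9p3:
  fixes \<tau> :: "(real \<times> real) set"
  assumes "\<tau> = {(u, v). 0 \<le> v \<and> v \<le> 1 \<and> 0 \<le> u \<and> u \<le> ((v - 1) / (v + 1))\<^sup>2}"
  shows "(sup_rec_transfinite_diameter (real_to_C2 \<tau>))\<^sup>2 < ennreal 0.023"
proof -
  let ?e = "exp (ln \<Lambda> / 54)"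
  \<comment> \<open>Since \<open>54 = 2 * 27\<close>, the 27th power of \<open>?e\<^sup>2\<close> is
    \<open>\<Lambda>\<close>, and only a comparison of rationals remains.\<close>
  have "(?e\<^sup>2) ^ 27 = exp (real 54 * (ln \<Lambda> / 54))"
    by (simp only: exp_of_nat_mult flip: power_mult) simp
  also have "\<dots> < 0.023 ^ 27"
    using \<Lambda>_bounds by simp
  finally have "?e\<^sup>2 < 0.023"
    by (rule power_less_imp_less_base) simp
  have "(sup_rec_transfinite_diameter (real_to_C2 \<tau>))\<^sup>2 \<le> (ennreal ?e)\<^sup>2"
    using sup_rec_transfinite_diameter_region unfolding assms region_def by (rule power_mono) simp
  also have "\<dots> = ennreal (?e\<^sup>2)"
    by (simp add: ennreal_power)
  also have "\<dots> < ennreal 0.023"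
    using \<open>?e\<^sup>2 < 0.023\<close> by (intro ennreal_lessI) auto
  finally show ?thesis .
qed

end
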